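(* Let $d\ge 1$ be an integer. For an integer base $b\ge 2$ and $k\ge 1$, let $N_k=b^{2^k}-1$. Then there exist infinitely many bases $b\ge 2$ such that, for every $k\ge 1$ and every integer $i$ with $1\le i\le d$, $N_k$ is a degree $i$ $b$-Niven number.
   Context: For an integer base $b\ge 2$ and a positive integer $N$, let $s_b(N)$ denote the sum of the base $b$ digits of $N$. A positive integer $N$ is a $b$-Niven number if $s_b(N)$ divides $N$. For an integer $m\ge 1$, a positive integer $N$ is a degree $m$ $b$-Niven number if both $N$ and $N^m$ are $b$-Niven numbers. *)

theory Defs
  imports Main
begin

definition digit :: "nat \<Rightarrow> nat \<Rightarrow> nat \<Rightarrow> nat" where
  "digit b N i = N div b ^ i mod b"

text \<open>For \<open>b \<ge> 2\<close> the index set is finite and consists of the positions up to the leading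
  digit of \<open>N\<close>; the definition is meaningful only for such \<open>b\<close>.\<close>

definition digit_sum :: "nat \<Rightarrow> nat \<Rightarrow> nat" where
  "digit_sum b N = (\<Sum>i | b ^ i \<le> N. digit b N i)"

lemma finite_digit_positions:
  fixes b N :: nat
  assumes "b \<ge> 2"
  shows "finite {i. b ^ i \<le> N}"
proof (rule finite_subset)
  have "i \<le> N" if "b ^ i \<le> N" for i
  proof -
    have "i < 2 ^ i" by (rule less_exp)
    also have "2 ^ i \<le> b ^ i" using assms by (rule power_mono) simp
    finally show ?thesis using that by simp
  qed
  then show "{i. b ^ i \<le> N} \<subseteq> {..N}" by auto
qed simp

lemma digit_less: "b \<ge> 2 \<Longrightarrow> digit b N i < b"
  by (simp add: digit_def)

lemma digit_sum_rec:
  assumes "b \<ge> 2" and "N > 0"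
  shows "digit_sum b N = N mod b + digit_sum b (N div b)"
proof -
  have iff: "b ^ Suc i \<le> N \<longleftrightarrow> b ^ i \<le> N div b" for i
    using assms(1) by (simp add: less_eq_div_iff_mult_less_eq mult.commute)
  have split: "{i. b ^ i \<le> N} = insert 0 (Suc ` {i. b ^ i \<le> N div b})" (is "?A = ?B")
  proof (rule set_eqI)
    fix i show "i \<in> ?A \<longleftrightarrow> i \<in> ?B"
      using assms(2) iff by (cases i) (auto simp del: power_Suc)
  qed
  have "digit_sum b N = digit b N 0 + (\<Sum>i | b ^ i \<le> N div b. digit b N (Suc i))"
    unfolding digit_sum_def split
    using finite_digit_positions[OF assms(1)] by (simp add: sum.reindex)
  then show ?thesis
    by (simp add: digit_sum_def digit_def div_mult2_eq)
qed

definition niven :: "nat \<Rightarrow> nat \<Rightarrow> bool" where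
  "niven b N \<longleftrightarrow> N > 0 \<and> digit_sum b N dvd N"

definition degree_niven :: "nat \<Rightarrow> nat \<Rightarrow> nat \<Rightarrow> bool" where
  "degree_niven m b N \<longleftrightarrow> niven b N \<and> niven b (N ^ m)"

end

theory Submission
  imports Defs "HOL-Library.Infinite_Set"
begin

text \<open>Put \<open>B = b ^ n\<close>. If all binomial coefficients \<open>m choose i\<close> are at most \<open>b\<close>, then the
  alternating expansion of \<open>(B - 1) ^ m\<close> in powers of \<open>B\<close> can be grouped into pairs
  \<open>(p * B - q) * B ^ l\<close> whose base-\<open>b\<close> digits do not interact. Each pair has digit sum
  \<open>n * (b - 1) + p - q\<close>, and the alternating sum of the binomial coefficients vanishes, so the digit
  sum of \<open>(B - 1) ^ m\<close> is \<open>\<lceil>m / 2\<rceil> * n * (b - 1)\<close>. For \<open>n = 2 ^ k\<close> and odd \<open>b\<close> the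
  number \<open>n * (b - 1)\<close> divides \<open>B - 1\<close>, and when \<open>fact d\<close> divides \<open>b - 1\<close> a second
  factor \<open>B - 1\<close> absorbs \<open>\<lceil>m / 2\<rceil>\<close>.\<close>

section \<open>Digit sums of concatenated digit blocks\<close>

lemma digit_sum_0 [simp]: "b \<ge> 2 \<Longrightarrow> digit_sum b 0 = 0"
  by (simp add: digit_sum_def)

lemma digit_sum_mod_div:
  assumes "b \<ge> 2"
  shows "digit_sum b N = N mod b + digit_sum b (N div b)"
  using assms digit_sum_rec[OF assms] by (cases "N = 0") auto

lemma digit_sum_lt:
  assumes "b \<ge> 2" "c < b"
  shows "digit_sum b c = c"
  using digit_sum_mod_div[of b c] assms by simp

text \<open>\<open>r\<close> fills only the lowest \<open>L\<close> positions, so it meets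
  \<open>q\<close> without carries, and padding zeros add nothing to a digit sum. The induction
  strips the last digit of \<open>r\<close>.\<close>

lemma digit_sum_append:
  assumes "b \<ge> 2" "r < b ^ L"
  shows "digit_sum b (q * b ^ L + r) = digit_sum b q + digit_sum b r"
  using assms(2)
proof (induction L arbitrary: r)
  case 0
  then show ?case using assms(1) by simp
next
  case (Suc L)
  have eq: "q * b ^ Suc L + r = r + b * (q * b ^ L)"
    by simp
  have m: "(q * b ^ Suc L + r) mod b = r mod b"
    unfolding eq by simp
  have d: "(q * b ^ Suc L + r) div b = q * b ^ L + r div b"
    unfolding eq using assms(1) by simp
  have "r div b < b ^ L"
    using Suc.prems assms(1) by (simp add: div_less_iff_less_mult mult.commute)
  then show ?case
    using digit_sum_mod_div[OF assms(1), of "q * b ^ Suc L + r"]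
      digit_sum_mod_div[OF assms(1), of r] Suc.IH[of "r div b"]
    unfolding m d by simp
qed

text \<open>Bounds the lower blocks, so that \<open>digit_sum_append\<close> can put the next block
  in front of them.\<close>

lemma sum_blocks_less:
  fixes Q :: "nat \<Rightarrow> nat"
  assumes "\<And>j. j < r \<Longrightarrow> Q j < M"
  shows "(\<Sum>j<r. Q j * M ^ j) < M ^ r"
  using assms
proof (induction r)
  case (Suc r)
  have "(\<Sum>j<r. Q j * M ^ j) < M ^ r"
    using Suc by simp
  moreover have "Suc (Q r) * M ^ r \<le> M * M ^ r"
    using Suc.prems[of r] by (intro mult_right_mono) auto
  ultimately show ?case by simp
qed simp

lemma digit_sum_blocks:
  assumes "b \<ge> 2" "\<And>j. j < r \<Longrightarrow> Q j < b ^ L"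
  shows "digit_sum b (\<Sum>j<r. Q j * (b ^ L) ^ j) = (\<Sum>j<r. digit_sum b (Q j))"
  using assms(2)
proof (induction r)
  case 0
  then show ?case using assms(1) by simp
next
  case (Suc r)
  have "(\<Sum>j<r. Q j * (b ^ L) ^ j) < b ^ (L * r)"
    using sum_blocks_less[of r Q "b ^ L"] Suc.prems by (simp add: power_mult)
  from digit_sum_append[OF assms(1) this, of "Q r"] Suc show ?case
    by (simp add: power_mult add.commute)
qed

section \<open>Digit sums of numbers \<open>p * b ^ n - q\<close>\<close>

lemma digit_sum_power_minus_1:
  assumes "b \<ge> 2"
  shows "digit_sum b (b ^ n - 1) = n * (b - 1)"
proof (induction n)
  case 0
  then show ?case using assms by simp
next
  case (Suc n)
  have "b ^ Suc n - 1 = (b - 1) * b ^ n + (b ^ n - 1)"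
    using assms by (simp add: diff_mult_distrib)
  then show ?case
    using digit_sum_append[OF assms, of "b ^ n - 1" n "b - 1"] digit_sum_lt[OF assms, of "b - 1"]
      assms Suc by simp
qed

text \<open>Borrowing one unit \<open>b ^ n\<close> from \<open>p\<close> leaves
  \<open>p - 1\<close> on top, then \<open>n - 1\<close> digits \<open>b - 1\<close> and a last
  digit \<open>b - q\<close>; the ranges of \<open>p\<close> and \<open>q\<close> make these genuine
  digits. Adding \<open>q\<close> on the left avoids truncated subtraction.\<close>

lemma digit_sum_pair:
  assumes b: "b \<ge> 2" and n: "n \<ge> 1" and p: "1 \<le> p" "p \<le> b" and q: "1 \<le> q" "q \<le> b"
  shows "digit_sum b (p * b ^ n - q) + q = n * (b - 1) + p"
    and "p * b ^ n - q < b ^ (2 * n)"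
    and "q \<le> p * b ^ n"
proof -
  obtain l where l: "n = Suc l" using n by (cases n) auto
  have bn: "b \<le> b ^ n" using b n by (simp add: self_le_power)
  have top: "p * b ^ n - q = (p - 1) * b ^ n + (b ^ n - q)"
    using p q bn by (simp add: diff_mult_distrib)
  have "b \<le> b ^ l * b"
    using b by simp
  then have low: "b ^ n - q = (b ^ l - 1) * b ^ 1 + (b - q)"
    using q by (simp add: l diff_mult_distrib mult.commute[of b])
  have "digit_sum b (b ^ n - q) = l * (b - 1) + (b - q)"
    unfolding low using digit_sum_append[OF b, of "b - q" 1 "b ^ l - 1"] b q
    by (simp add: digit_sum_lt digit_sum_power_minus_1[simplified])
  moreover have "b ^ n - q < b ^ n"
    using q b by simp
  ultimately have "digit_sum b (p * b ^ n - q) = (p - 1) + (l * (b - 1) + (b - q))"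
    unfolding top using digit_sum_append[OF b, of "b ^ n - q" n "p - 1"] p
    by (simp add: digit_sum_lt[OF b])
  then show "digit_sum b (p * b ^ n - q) + q = n * (b - 1) + p"
    using p q b by (simp add: l)
  show le: "q \<le> p * b ^ n"
    using q(2) bn mult_le_mono1[OF p(1), of "b ^ n"] unfolding mult_1 by (meson le_trans)
  have "p * b ^ n \<le> b ^ n * b ^ n"
    using p bn by (intro mult_right_mono) auto
  then show "p * b ^ n - q < b ^ (2 * n)"
    unfolding mult_2 power_add using le q(1) by linarith
qed

text \<open>Each pair fits into \<open>2 * n\<close> digits, exactly the spacing of the powers
  \<open>(b ^ n) ^ (2 * j)\<close>, so the blocks do not overlap. \<open>S\<close> is given by an
  integer sum because the pairs come from an alternating expansion.\<close>

lemma digit_sum_sum_pairs: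
  fixes p q :: "nat \<Rightarrow> nat"
  assumes b: "b \<ge> 2" and n: "n \<ge> 1"
    and p: "\<And>j. j < r \<Longrightarrow> 1 \<le> p j \<and> p j \<le> b"
    and q: "\<And>j. j < r \<Longrightarrow> 1 \<le> q j \<and> q j \<le> b"
    and S: "int S = (\<Sum>j<r. (int (p j) * int (b ^ n) - int (q j)) * int (b ^ n) ^ (2 * j))"
  shows "digit_sum b S + (\<Sum>j<r. q j) = r * (n * (b - 1)) + (\<Sum>j<r. p j)"
proof -
  define Q where "Q j = p j * b ^ n - q j" for j
  have *: "digit_sum b (Q j) + q j = n * (b - 1) + p j" "Q j < b ^ (2 * n)" "q j \<le> p j * b ^ n"
    if "j < r" for j
    using digit_sum_pair[OF b n, of "p j" "q j"] p[OF that] q[OF that] by (auto simp: Q_def)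
  have "int S = int (\<Sum>j<r. Q j * (b ^ (2 * n)) ^ j)"
    unfolding S of_nat_sum
  proof (rule sum.cong)
    fix j assume "j \<in> {..<r}"
    then show "(int (p j) * int (b ^ n) - int (q j)) * int (b ^ n) ^ (2 * j)
        = int (Q j * (b ^ (2 * n)) ^ j)"
      using *(3)[of j]
      by (simp add: Q_def of_nat_diff flip: power_mult) (simp add: mult_ac)
  qed simp
  then have "S = (\<Sum>j<r. Q j * (b ^ (2 * n)) ^ j)"
    by (simp only: of_nat_eq_iff)
  then have "digit_sum b S = (\<Sum>j<r. digit_sum b (Q j))"
    using digit_sum_blocks[OF b, of r Q "2 * n"] *(2) by simp
  then have "digit_sum b S + (\<Sum>j<r. q j) = (\<Sum>j<r. digit_sum b (Q j) + q j)"
    by (simp add: sum.distrib)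
  also have "\<dots> = (\<Sum>j<r. n * (b - 1) + p j)"
    using *(1) by (intro sum.cong) auto
  finally show ?thesis by (simp add: sum.distrib)
qed

section \<open>Pairing the alternating expansion of \<open>(x - 1) ^ m\<close>\<close>

lemma sum_lessThan_double:
  fixes f :: "nat \<Rightarrow> 'a::comm_monoid_add"
  shows "(\<Sum>i<2 * r. f i) = (\<Sum>j<r. f (2 * j) + f (2 * j + 1))"
  by (induction r) (simp_all add: add.assoc)

lemma binomial_minus_1:
  fixes x :: int
  shows "(x - 1) ^ m = (\<Sum>i\<le>m. int (m choose i) * x ^ i * (- 1) ^ (m - i))"
  using binomial_ring[of x "- 1" m] by simp

text \<open>With \<open>m\<close> odd there are evenly many terms; each even exponent, with sign
  minus, joins the next odd one.\<close>

lemma power_odd_pairs: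
  fixes x :: int
  assumes m: "m = 2 * r + 1"
  shows "(x - 1) ^ m =
    (\<Sum>j<Suc r. (int (m choose (2 * j + 1)) * x - int (m choose (2 * j))) * x ^ (2 * j))"
proof -
  have "{..m} = {..<2 * Suc r}"
    using m by auto
  then have "(x - 1) ^ m = (\<Sum>i<2 * Suc r. int (m choose i) * x ^ i * (- 1) ^ (m - i))"
    by (simp only: binomial_minus_1)
  also have "\<dots> =
      (\<Sum>j<Suc r. (int (m choose (2 * j + 1)) * x - int (m choose (2 * j))) * x ^ (2 * j))"
    unfolding sum_lessThan_double
  proof (rule sum.cong)
    fix j assume "j \<in> {..<Suc r}"
    then have "odd (m - 2 * j)" "even (m - (2 * j + 1))"
      using m by auto
    then show "int (m choose (2 * j)) * x ^ (2 * j) * (- 1) ^ (m - 2 * j)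
        + int (m choose (2 * j + 1)) * x ^ (2 * j + 1) * (- 1) ^ (m - (2 * j + 1))
        = (int (m choose (2 * j + 1)) * x - int (m choose (2 * j))) * x ^ (2 * j)"
      by (simp add: algebra_simps)
  qed simp
  finally show ?thesis .
qed

text \<open>With \<open>m\<close> even the constant term 1 is left over. The pairs then start at
  exponent 1, and factoring out \<open>x\<close> gives them the same shape as in the odd
  case.\<close>

lemma power_even_pairs:
  fixes x :: int
  assumes m: "m = 2 * r"
  shows "(x - 1) ^ m = 1 + x *
    (\<Sum>j<r. (int (m choose (2 * j + 2)) * x - int (m choose (2 * j + 1))) * x ^ (2 * j))"
proof -
  define f where "f i = int (m choose i) * x ^ i * (- 1) ^ (m - i)" for i
  have "(x - 1) ^ m = (\<Sum>i<Suc (2 * r). f i)"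
    unfolding binomial_minus_1 f_def m lessThan_Suc_atMost ..
  also have "\<dots> = f 0 + (\<Sum>j<r. f (Suc (2 * j)) + f (Suc (2 * j + 1)))"
    by (simp only: sum.lessThan_Suc_shift sum_lessThan_double[of "\<lambda>i. f (Suc i)"])
  also have "f 0 = 1"
    by (simp add: f_def m)
  also have "(\<Sum>j<r. f (Suc (2 * j)) + f (Suc (2 * j + 1))) = x *
      (\<Sum>j<r. (int (m choose (2 * j + 2)) * x - int (m choose (2 * j + 1))) * x ^ (2 * j))"
    unfolding sum_distrib_left
  proof (rule sum.cong)
    fix j assume "j \<in> {..<r}"
    then have "odd (m - Suc (2 * j))" "even (m - Suc (2 * j + 1))"
      using m by auto
    then show "f (Suc (2 * j)) + f (Suc (2 * j + 1)) =
        x * ((int (m choose (2 * j + 2)) * x - int (m choose (2 * j + 1))) * x ^ (2 * j))"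
      by (simp add: f_def algebra_simps)
  qed simp
  finally show ?thesis .
qed

text \<open>The factor \<open>(m + 1) div 2\<close> counts the pairs. The bound
  \<open>2 ^ m \<le> b\<close> keeps every binomial coefficient within the range allowed for a
  pair.\<close>

lemma digit_sum_power_minus_1_power:
  assumes b: "b \<ge> 2" and n: "n \<ge> 1" and m: "m \<ge> 1" and bm: "2 ^ m \<le> b"
  shows "digit_sum b ((b ^ n - 1) ^ m) = (m + 1) div 2 * (n * (b - 1))"
proof -
  define B where "B = b ^ n"
  have B: "B \<ge> 2"
    using b n self_le_power[of b n] by (simp add: B_def)
  have int_B: "int ((B - 1) ^ m) = (int B - 1) ^ m"
    using B by (simp add: of_nat_diff)
  have bin: "1 \<le> m choose i \<and> m choose i \<le> b" if "i \<le> m" for i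
    using that bm binomial_le_pow2[of m i] by (auto simp: Suc_le_eq intro: le_trans)
  show ?thesis
  proof (cases "even m")
    case False
    then obtain r where r: "m = 2 * r + 1" by (rule oddE)
    define p where "p j = m choose (2 * j + 1)" for j
    define q where "q j = m choose (2 * j)" for j
    have "digit_sum b ((B - 1) ^ m) + (\<Sum>j<Suc r. q j) =
        Suc r * (n * (b - 1)) + (\<Sum>j<Suc r. p j)"
    proof (rule digit_sum_sum_pairs[OF b n])
      show "int ((B - 1) ^ m) =
          (\<Sum>j<Suc r. (int (p j) * int (b ^ n) - int (q j)) * int (b ^ n) ^ (2 * j))"
        unfolding int_B power_odd_pairs[OF r] p_def q_def unfolding B_def ..
    qed (simp_all only: p_def q_def, (rule bin, simp add: r)+)
    \<comment> \<open>At \<open>x = 1\<close> the paired expansion has value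
      \<open>0 ^ m = 0\<close>.\<close>
    moreover have "int (\<Sum>j<Suc r. p j) = int (\<Sum>j<Suc r. q j)"
      using power_odd_pairs[OF r, of 1] m
      by (simp add: p_def q_def sum_subtractf power_0_left del: sum.lessThan_Suc)
    then have "(\<Sum>j<Suc r. p j) = (\<Sum>j<Suc r. q j)"
      by (simp only: of_nat_eq_iff)
    ultimately show ?thesis
      by (simp add: B_def r del: sum.lessThan_Suc)
  next
    case True
    then obtain r where r: "m = 2 * r" by (rule evenE)
    define p where "p j = m choose (2 * j + 2)" for j
    define q where "q j = m choose (2 * j + 1)" for j
    \<comment> \<open>\<open>T\<close> below is an integer; this exact quotient is the natural
      number equal to it, to which \<open>digit_sum\<close> applies.\<close>
    define S where "S = ((B - 1) ^ m - 1) div B"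
    define T where "T = (\<Sum>j<r. (int (p j) * int B - int (q j)) * int B ^ (2 * j))"
    have eq: "int ((B - 1) ^ m) = 1 + int B * T"
      unfolding int_B T_def p_def q_def power_even_pairs[OF r] ..
    have pos: "(B - 1) ^ m \<ge> 1"
      using B by simp
    have "int S = T"
      unfolding S_def zdiv_int of_nat_diff[OF pos] eq using B by simp
    have "int ((B - 1) ^ m) = int (S * B + 1)"
      unfolding eq \<open>int S = T\<close>[symmetric] by simp
    then have split: "(B - 1) ^ m = S * b ^ n + 1"
      unfolding B_def[symmetric] by (simp only: of_nat_eq_iff)
    have "digit_sum b S + (\<Sum>j<r. q j) = r * (n * (b - 1)) + (\<Sum>j<r. p j)"
    proof (rule digit_sum_sum_pairs[OF b n])
      show "int S =
          (\<Sum>j<r. (int (p j) * int (b ^ n) - int (q j)) * int (b ^ n) ^ (2 * j))"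
        using \<open>int S = T\<close> by (simp add: T_def B_def)
    qed (simp_all only: p_def q_def, (rule bin, simp add: r)+)
    \<comment> \<open>Again the expansion at \<open>x = 1\<close>. The excess 1 is offset by the
      last digit 1 of \<open>(B - 1) ^ m\<close>.\<close>
    moreover have "int (\<Sum>j<r. q j) = 1 + int (\<Sum>j<r. p j)"
      using power_even_pairs[OF r, of 1] m
      by (simp add: p_def q_def sum_subtractf power_0_left)
    then have "(\<Sum>j<r. q j) = 1 + (\<Sum>j<r. p j)"
      by linarith
    moreover have "digit_sum b ((B - 1) ^ m) = digit_sum b S + 1"
      unfolding split using digit_sum_append[OF b, of 1 n S] B digit_sum_lt[OF b, of 1] b
      by (simp add: B_def)
    ultimately show ?thesis
      by (simp add: B_def r)
  qed
qed

section \<open>Divisibility and the choice of bases\<close>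

lemma mult_dvd_power_two_power_minus_1:
  assumes "odd b"
  shows "2 ^ k * (b - 1) dvd b ^ (2 ^ k) - (1::nat)"
proof (induction k)
  case (Suc k)
  \<comment> \<open>A difference of squares: the new factor is even for odd \<open>b\<close> and
    supplies the additional 2.\<close>
  have "(b ^ (2 ^ k) + 1) * (b ^ (2 ^ k) - 1) = b ^ (2 ^ Suc k) - 1"
    by (simp add: algebra_simps power_add mult_2 flip: power_mult)
  moreover have "2 dvd b ^ (2 ^ k) + 1"
    using assms by simp
  ultimately show ?case
    using mult_dvd_mono[OF _ Suc, of 2 "b ^ (2 ^ k) + 1"] by (simp add: mult.assoc)
qed simp

lemma niven_power:
  assumes m: "1 \<le> m" "m \<le> d" and b: "b \<ge> 2" "2 ^ d \<le> b" "odd b" "fact d dvd b - 1"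
  shows "niven b ((b ^ (2 ^ k) - 1) ^ m)"
proof -
  define N where "N = b ^ (2 ^ k) - 1"
  have "b ^ (2 ^ k) > 1"
    using b(1) by (intro one_less_power) auto
  then have "N > 0"
    by (simp add: N_def)
  have "(2::nat) ^ m \<le> 2 ^ d"
    using m by (intro power_increasing) auto
  then have "2 ^ m \<le> b"
    using b(2) by (rule le_trans)
  then have ds: "digit_sum b (N ^ m) = (m + 1) div 2 * (2 ^ k * (b - 1))"
    unfolding N_def using m b by (intro digit_sum_power_minus_1_power) auto
  have dvd: "2 ^ k * (b - 1) dvd N"
    unfolding N_def by (rule mult_dvd_power_two_power_minus_1[OF b(3)])
  have "(m + 1) div 2 * (2 ^ k * (b - 1)) dvd N ^ m"
  \<comment> \<open>For \<open>m = 1\<close> there is only one factor \<open>N\<close>, but then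
    \<open>(m + 1) div 2\<close> is 1 and nothing more has to be absorbed.\<close>
  proof (cases "m = 1")
    case True
    then show ?thesis using dvd by simp
  next
    case False
    have "(m + 1) div 2 dvd fact d"
      using m by (intro dvd_fact) auto
    also note b(4)
    also have "b - 1 dvd N"
      using dvd by (rule dvd_mult_right)
    finally have "(m + 1) div 2 * (2 ^ k * (b - 1)) dvd N ^ 2"
      using dvd unfolding power2_eq_square by (rule mult_dvd_mono)
    also have "N ^ 2 dvd N ^ m"
      using m False by (intro le_imp_power_dvd) auto
    finally show ?thesis .
  qed
  then show ?thesis
    unfolding N_def[symmetric] niven_def using \<open>N > 0\<close> ds by simp
qed

theorem theorem3:
  fixes d :: nat
  assumes "d \<ge> 1"
  shows "infinite {b :: nat. b \<ge> 2 \<and>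
    (\<forall>k\<ge>1. \<forall>i. 1 \<le> i \<and> i \<le> d \<longrightarrow> degree_niven i b (b ^ (2 ^ k) - 1))}"
  unfolding infinite_nat_iff_unbounded_le
proof (intro allI)
  fix t :: nat
  \<comment> \<open>The factor \<open>2 ^ d\<close> makes \<open>b\<close> odd and at least
    \<open>2 ^ d\<close>, \<open>fact d\<close> gives the divisibility of \<open>b - 1\<close>, and
    \<open>Suc t\<close> pushes \<open>b\<close> beyond \<open>t\<close>.\<close>
  define b where "b = 2 ^ d * fact d * Suc t + (1::nat)"
  have "1 * 1 * Suc t \<le> 2 ^ d * fact d * Suc t"
    by (intro mult_le_mono) (auto simp: fact_ge_1)
  then have tb: "t \<le> b" "b \<ge> 2"
    by (auto simp: b_def)
  have "2 ^ d * 1 * 1 \<le> 2 ^ d * fact d * Suc t"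
    by (intro mult_le_mono) (auto simp: fact_ge_1)
  then have "2 ^ d \<le> b"
    by (simp add: b_def)
  moreover have "odd b" "fact d dvd b - 1"
    using assms by (auto simp: b_def)
  ultimately have niven: "niven b ((b ^ (2 ^ k) - 1) ^ m)" if "1 \<le> m" "m \<le> d" for m k
    using that tb(2) by (intro niven_power)
  have "degree_niven i b (b ^ (2 ^ k) - 1)" if "1 \<le> i" "i \<le> d" for i k
    using niven[of 1 k] niven[OF that, of k] assms by (simp add: degree_niven_def)
  then show "\<exists>n\<ge>t. n \<in> {b :: nat. b \<ge> 2 \<and>
      (\<forall>k\<ge>1. \<forall>i. 1 \<le> i \<and> i \<le> d \<longrightarrow> degree_niven i b (b ^ (2 ^ k) - 1))}"
    using tb by blast
qed

end
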